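(* Let $K$ be a field of characteristic $2$ and let $L$ be a Galois extension field of degree four over $K$ with cyclic Galois group. Then there exists a four-dimensional $K$-subspace $\mathcal{M}$ of $M_4(K)$ such that the elements of $\mathcal{M}$ with determinant zero form a one-dimensional subspace, $\mathcal{M}$ contains the identity matrix, and the non-zero elements of $\mathcal{M}$ of determinant zero have rank two and are nilpotent.
   Context: $M_4(K)$ is the $K$-vector space of $4\times 4$ matrices over $K$. *)

theory Defs
  imports
    "HOL-Analysis.Analysis"
    "HOL-Algebra.Elementary_Groups"
    "HOL-Computational_Algebra.Computational_Algebra"
begin

definition matrix_scale :: "'k::field \<Rightarrow> 'k^'n^'m \<Rightarrow> 'k^'n^'m"
  where "matrix_scale c A = (\<chi> i j. c * A $ i $ j)"

global_interpretation matsp: vector_space "matrix_scale :: 'k::field \<Rightarrow> 'k^'n^'m \<Rightarrow> 'k^'n^'m"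
  by unfold_locales (simp_all add: matrix_scale_def vec_eq_iff algebra_simps)

text \<open>The type class power on the vector type is componentwise, so powers of a matrix are
  iterated with the matrix product instead.\<close>

definition nilpotent_matrix :: "'k::field^'n^'n \<Rightarrow> bool"
  where "nilpotent_matrix A \<longleftrightarrow> (\<exists>r. (((**) A) ^^ r) (mat 1) = 0)"

definition field_hom :: "('k::field \<Rightarrow> 'l::field) \<Rightarrow> bool"
  where "field_hom f \<longleftrightarrow>
    f 1 = 1 \<and> (\<forall>x y. f (x + y) = f x + f y) \<and> (\<forall>x y. f (x * y) = f x * f y)"

text \<open>An extension field of the field \<open>'k\<close> is a field \<open>'l\<close> together with a (necessarily injective)
  field homomorphism \<open>\<iota>\<close>, along which \<open>'k\<close> is identified with the subfield \<open>range \<iota>\<close>.\<close>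

locale field_extension =
  fixes \<iota> :: "'k::field \<Rightarrow> 'l::field"
  assumes hom: "field_hom \<iota>"

definition ext_scale :: "('k::field \<Rightarrow> 'l::field) \<Rightarrow> 'k \<Rightarrow> 'l \<Rightarrow> 'l"
  where "ext_scale \<iota> c x = \<iota> c * x"

sublocale field_extension \<subseteq> ext: vector_space "ext_scale \<iota>"
  using hom by unfold_locales (simp_all add: ext_scale_def field_hom_def algebra_simps)

text \<open>Infinite extensions get degree \<open>0\<close>.\<close>

definition ext_degree :: "('k::field \<Rightarrow> 'l::field) \<Rightarrow> nat"
  where "ext_degree \<iota> = vector_space.dim (ext_scale \<iota>) UNIV"

definition algebraic_extension :: "('k::field \<Rightarrow> 'l::field) \<Rightarrow> bool"
  where "algebraic_extension \<iota> \<longleftrightarrow>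
    field_extension \<iota> \<and> (\<forall>x. \<exists>p. p \<noteq> 0 \<and> poly (map_poly \<iota> p) x = 0)"

definition galois_group :: "('k::field \<Rightarrow> 'l::field) \<Rightarrow> ('l \<Rightarrow> 'l) monoid"
  where "galois_group \<iota> =
    \<lparr>carrier = {\<sigma>. bij \<sigma> \<and> field_hom \<sigma> \<and> (\<forall>c. \<sigma> (\<iota> c) = \<iota> c)}, mult = (\<circ>), one = id\<rparr>"

lemma group_galois_group: "group (galois_group \<iota>)"
proof (rule groupI)
  fix \<sigma> assume s: "\<sigma> \<in> carrier (galois_group \<iota>)"
  then have b: "bij \<sigma>" and h: "field_hom \<sigma>" and f: "\<And>c. \<sigma> (\<iota> c) = \<iota> c"
    by (auto simp: galois_group_def)
  have [simp]: "inv_into UNIV \<sigma> (\<sigma> x) = x" "\<sigma> (inv_into UNIV \<sigma> x) = x" for x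
    using b by (auto simp: bij_is_inj bij_is_surj surj_f_inv_f)
  have eqI: "inv_into UNIV \<sigma> x = y" if "x = \<sigma> y" for x y
    using that by simp
  have "field_hom (inv_into UNIV \<sigma>)"
    using h unfolding field_hom_def by (auto intro!: eqI)
  moreover have "inv_into UNIV \<sigma> (\<iota> c) = \<iota> c" for c
    by (rule eqI) (simp add: f)
  ultimately have "inv_into UNIV \<sigma> \<in> carrier (galois_group \<iota>)"
    using b by (auto simp: galois_group_def bij_imp_bij_inv)
  moreover have "inv_into UNIV \<sigma> \<circ> \<sigma> = id"
    by auto
  ultimately show "\<exists>\<tau>\<in>carrier (galois_group \<iota>). \<tau> \<otimes>\<^bsub>galois_group \<iota>\<^esub> \<sigma> = \<one>\<^bsub>galois_group \<iota>\<^esub>"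
    by (intro bexI[of _ "inv_into UNIV \<sigma>"]) (simp_all add: galois_group_def)
qed (auto simp: galois_group_def field_hom_def bij_comp comp_assoc)

text \<open>Algebraic, with the base field as the fixed field of the automorphism group.\<close>

definition galois_extension :: "('k::field \<Rightarrow> 'l::field) \<Rightarrow> bool"
  where "galois_extension \<iota> \<longleftrightarrow>
    algebraic_extension \<iota> \<and> {x. \<forall>\<sigma>\<in>carrier (galois_group \<iota>). \<sigma> x = x} = range \<iota>"

end

theory Submission
  imports Defs
begin

text \<open>It suffices that \<open>K\<close> has an irreducible quadratic \<open>s\<^sup>2 - p s - q\<close>, with root \<open>e\<close> and
  conjugate \<open>e' = p - e\<close>. Viewing \<open>2 \<times> 2\<close> matrices over \<open>K(e)\<close> as \<open>4 \<times> 4\<close> matrices over \<open>K\<close>, take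
  the space of all matrices with rows \<open>(a + b e, t + c e)\<close> and \<open>(c, a + b e')\<close>, where
  \<open>a, b, c, t\<close> range over \<open>K\<close>. The determinant over \<open>K(e)\<close> is \<open>N(a + b e) - c t - c\<^sup>2 e\<close>. If it is
  zero, comparing the coefficients of \<open>e\<close> gives \<open>c = 0\<close>, and then \<open>N(a + b e) = 0\<close> gives
  \<open>a = b = 0\<close>. The remaining matrices have the single entry \<open>t\<close> above the diagonal: rank one
  over \<open>K(e)\<close>, hence rank two over \<open>K\<close>, and square zero.

  For the quadratic, let \<open>\<sigma>\<close> generate the Galois group. An element of \<open>L\<close> is a root of a polynomial
  of degree at most four over \<open>K\<close>, so its \<open>\<sigma>\<close>-orbit has at most four elements. Orbits of length two
  or four yield elements of degree two. If there are none, then \<open>\<sigma>\<^sup>3 = 1\<close>; for \<open>a\<close> outside \<open>K\<close>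
  the three functionals \<open>Tr(x)\<close>, \<open>Tr(a x)\<close>, \<open>Tr(a\<^sup>2 x)\<close> on the four-dimensional \<open>L\<close> have a common
  nontrivial zero, which a Vandermonde argument excludes.\<close>

text \<open>Drops the power series notation that competes with vector indexing.\<close>
unbundle no Formal_Power_Series.fps_syntax

text \<open>The map with coordinates \<open>f\<close>, \<open>g\<close>, \<open>h\<close> cannot be
  injective on \<open>span B\<close>: it would carry \<open>B\<close> to more than three independent
  vectors of a three-dimensional space.\<close>

lemma (in vector_space) common_kernel_of_three_functionals:
  assumes "finite B" "independent B" "card B > 3"
    and "Vector_Spaces.linear scale (*) f" "Vector_Spaces.linear scale (*) g" "Vector_Spaces.linear scale (*) h"
  obtains x where "x \<noteq> 0" "f x = 0" "g x = 0" "h x = 0"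
proof -
  interpret pr: vector_space_pair scale "(*s) :: 'a \<Rightarrow> 'a^3 \<Rightarrow> 'a^3" ..
  interpret f: Vector_Spaces.linear scale "(*)" f by fact
  interpret g: Vector_Spaces.linear scale "(*)" g by fact
  interpret h: Vector_Spaces.linear scale "(*)" h by fact
  define \<phi> where "\<phi> x = (vector [f x, g x, h x] :: 'a^3)" for x
  have lin: "Vector_Spaces.linear scale (*s) \<phi>"
    by unfold_locales
      (simp_all add: \<phi>_def vec_eq_iff forall_3 f.add g.add h.add f.scale g.scale h.scale)
  have "\<not> inj_on \<phi> (span B)"
  proof
    assume inj: "inj_on \<phi> (span B)"
    then have "vec.independent (\<phi> ` B)"
      by (rule pr.linear_independent_injective_image[OF lin assms(2)])
    then have "card (\<phi> ` B) \<le> vec.dim (UNIV :: ('a^3) set)"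
      by (intro vec.independent_card_le_dim) auto
    moreover have "card (\<phi> ` B) = card B"
      by (intro card_image inj_on_subset[OF inj]) (auto simp: span_base)
    ultimately show False
      using assms(3) by (simp add: vec.dim_UNIV vec.dimension_def card_cart_basis)
  qed
  then obtain x where "x \<noteq> 0" "\<phi> x = 0"
    using pr.linear_inj_on_iff_eq_0[OF lin subspace_span, of B] by blast
  then show thesis
    by (intro that[of x]) (simp_all add: \<phi>_def vec_eq_iff forall_3)
qed

section \<open>Quadratic elements in cyclic extensions of degree four\<close>

text \<open>Condenses the Galois hypotheses into one endomorphism with fixed field K, so that
  membership in \<open>range \<iota>\<close> is tested by applying \<open>\<sigma>\<close>.\<close>

locale cyclic_quartic = field_extension \<iota> for \<iota> :: "'k::field \<Rightarrow> 'l::field" +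
  fixes \<sigma> :: "'l \<Rightarrow> 'l"
  assumes dim_4: "ext.dim UNIV = 4"
    and \<sigma>_hom: "field_hom \<sigma>"
    and fixed_iff: "\<sigma> x = x \<longleftrightarrow> x \<in> range \<iota>"
begin

lemma \<iota>_simps [simp]:
  "\<iota> 1 = 1" "\<iota> (x + y) = \<iota> x + \<iota> y" "\<iota> (x * y) = \<iota> x * \<iota> y"
  using hom by (auto simp: field_hom_def)

lemma \<iota>_0 [simp]: "\<iota> 0 = 0"
proof -
  have "\<iota> 0 + \<iota> 0 = \<iota> 0 + 0"
    using \<iota>_simps(2)[of 0 0] by simp
  then show ?thesis
    by (rule add_left_imp_eq)
qed

lemma \<iota>_minus: "\<iota> (- x) = - \<iota> x"
  using \<iota>_simps(2)[of x "- x"] by (simp del: \<iota>_simps(2) add: minus_unique)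

lemma \<iota>_eq_0_iff [simp]: "\<iota> x = 0 \<longleftrightarrow> x = 0"
proof
  assume "\<iota> x = 0"
  then have "\<iota> (x * inverse x) = 0"
    by simp
  then show "x = 0"
    by (cases "x = 0") (auto simp del: \<iota>_simps(3))
qed simp

lemma \<sigma>_simps [simp]:
  "\<sigma> 1 = 1" "\<sigma> (x + y) = \<sigma> x + \<sigma> y" "\<sigma> (x * y) = \<sigma> x * \<sigma> y" "\<sigma> (\<iota> c) = \<iota> c"
  using \<sigma>_hom by (auto simp: field_hom_def fixed_iff)

lemma \<sigma>_0 [simp]: "\<sigma> 0 = 0"
  using \<sigma>_simps(4)[of 0] by simp

lemma inj_\<sigma>: "inj \<sigma>"
proof (rule injI)
  fix x y assume "\<sigma> x = \<sigma> y"
  then have "\<sigma> (x - y) = 0"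
    using \<sigma>_simps(2)[of "x - y" y] by simp
  then have "\<sigma> ((x - y) * inverse (x - y)) = 0"
    by (simp del: \<sigma>_simps(2))
  then show "x = y"
    by (cases "x = y") (auto simp del: \<sigma>_simps(2,3))
qed

lemma finite_basis:
  obtains B where "finite B" "ext.independent B" "ext.span B = UNIV" "card B = 4"
proof -
  obtain B where B: "ext.independent B" "UNIV \<subseteq> ext.span B" "card B = ext.dim UNIV"
    by (meson ext.basis_exists)
  show thesis
    by (rule that[of B]) (use B dim_4 in \<open>auto intro: card_ge_0_finite\<close>)
qed

lemma dependent_if_card_gt_4:
  assumes "finite S" "card S > 4"
  shows "ext.dependent S"
proof (rule ccontr)
  assume ind: "\<not> ext.dependent S"
  obtain B where B: "finite B" "ext.independent B" "ext.span B = UNIV" "card B = 4"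
    by (rule finite_basis)
  show False
    using ext.independent_span_bound[OF B(1) ind] B(3,4) assms(2) by simp
qed

lemma annihilating_polynomial:
  obtains P where "P \<noteq> 0" "degree P \<le> 4" "poly P x = 0" "\<And>i. coeff P i \<in> range \<iota>"
\<comment> \<open>Dependence is a property of sets, so coinciding powers are treated apart: they
  give the polynomial X^i - X^j.\<close>
proof (cases "inj_on (\<lambda>i. x ^ i) {..4::nat}")
  case True
  then have "ext.dependent ((\<lambda>i. x ^ i) ` {..4})"
    by (intro dependent_if_card_gt_4) (simp_all add: card_image)
  then obtain u where u: "\<exists>v\<in>(\<lambda>i. x ^ i) ` {..4}. u v \<noteq> 0"
      "(\<Sum>v\<in>(\<lambda>i. x ^ i) ` {..4}. ext_scale \<iota> (u v) v) = 0"
    by (subst (asm) ext.dependent_finite) auto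
  define P where "P = (\<Sum>i\<le>4. monom (\<iota> (u (x ^ i))) i)"
  have coeff_P: "coeff P i = (if i \<le> 4 then \<iota> (u (x ^ i)) else 0)" for i
    by (simp add: P_def coeff_sum)
  show thesis
  proof
    obtain i where "i \<le> 4" "u (x ^ i) \<noteq> 0"
      using u(1) by auto
    then have "coeff P i \<noteq> 0"
      by (simp add: coeff_P)
    then show "P \<noteq> 0"
      by auto
    show "degree P \<le> 4"
      by (rule degree_le) (simp add: coeff_P)
    show "poly P x = 0"
      using u(2) by (simp add: sum.reindex[OF True] P_def poly_sum poly_monom ext_scale_def)
    show "coeff P i \<in> range \<iota>" for i
      by (auto simp: coeff_P intro: range_eqI[of _ _ 0])
  qed
next
  case False
  then obtain i j where ij: "i < j" "j \<le> 4" "x ^ i = x ^ j"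
    by (auto simp: inj_on_def) (metis linorder_neqE_nat)
  have minus_1: "- 1 = \<iota> (- 1)"
    by (simp add: \<iota>_minus)
  show thesis
  proof
    show "monom 1 i - monom 1 j \<noteq> (0 :: 'l poly)"
      using ij(1) by (auto simp: poly_eq_iff)
    show "degree (monom 1 i - monom 1 j :: 'l poly) \<le> 4"
      using ij(1,2) by (intro degree_diff_le) (auto simp: degree_monom_eq)
    show "poly (monom 1 i - monom 1 j) x = 0"
      by (simp add: poly_monom ij(3))
    show "coeff (monom 1 i - monom 1 j :: 'l poly) k \<in> range \<iota>" for k
      using minus_1 ij(1) by (auto intro: range_eqI[of _ _ 0] range_eqI[of _ _ 1])
  qed
qed

lemma poly_\<sigma>:
  assumes "\<And>i. coeff P i \<in> range \<iota>"
  shows "poly P (\<sigma> x) = \<sigma> (poly P x)"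
proof -
  have 1: "\<sigma> (x ^ n) = \<sigma> x ^ n" for n
    by (induction n) simp_all
  have 2: "\<sigma> (sum f A) = (\<Sum>i\<in>A. \<sigma> (f i))" for f :: "nat \<Rightarrow> 'l" and A
    by (induction A rule: infinite_finite_induct) simp_all
  have "\<sigma> (coeff P i) = coeff P i" for i
    using assms fixed_iff by blast
  then show ?thesis
    by (simp add: poly_altdef 1 2)
qed

lemma orbit_length:
  obtains d where "d \<in> {1..4}" "(\<sigma> ^^ d) x = x"
proof -
  obtain P where P: "P \<noteq> 0" "degree P \<le> 4" "poly P x = 0" "\<And>i. coeff P i \<in> range \<iota>"
    using annihilating_polynomial[of x] by blast
  have root: "poly P ((\<sigma> ^^ i) x) = 0" for i
    by (induction i) (simp_all add: P(3) poly_\<sigma>[OF P(4)])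
  have "\<not> inj_on (\<lambda>i. (\<sigma> ^^ i) x) {..4}"
  proof
    assume "inj_on (\<lambda>i. (\<sigma> ^^ i) x) {..4}"
    then have "5 = card ((\<lambda>i. (\<sigma> ^^ i) x) ` {..4})"
      by (simp add: card_image)
    also have "\<dots> \<le> card {y. poly P y = 0}"
      by (intro card_mono poly_roots_finite P) (auto simp: root)
    also have "\<dots> \<le> degree P"
      by (intro card_poly_roots_bound P)
    finally show False
      using P(2) by simp
  qed
  then obtain i j where ij: "i < j" "j \<le> 4" "(\<sigma> ^^ i) x = (\<sigma> ^^ j) x"
    by (auto simp: inj_on_def) (metis linorder_neqE_nat)
  \<comment> \<open>Injectivity of \<open>\<sigma>\<close> cancels \<open>\<sigma> ^^ i\<close> from
    the coincidence, so the orbit returns to \<open>x\<close> itself.\<close>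
  have "(\<sigma> ^^ i) ((\<sigma> ^^ (j - i)) x) = (\<sigma> ^^ i) x"
    using ij by (simp flip: funpow_add add: comp_apply[symmetric, of "\<sigma> ^^ i"])
  then have "(\<sigma> ^^ (j - i)) x = x"
    using inj_\<sigma> by (meson inj_fn injD)
  then show thesis
    using ij(1,2) by (intro that[of "j - i"]) auto
qed

lemma range_eq_UNIV_if_order_3:
  assumes "\<And>x. \<sigma> (\<sigma> (\<sigma> x)) = x"
  shows "range \<iota> = UNIV"
proof (rule ccontr)
  assume "range \<iota> \<noteq> UNIV"
  then obtain a where a: "\<sigma> a \<noteq> a"
    using fixed_iff by blast
  let ?b = "\<sigma> a" and ?c = "\<sigma> (\<sigma> a)"
  have ac: "a \<noteq> ?c"
    using a assms[of a] by metis
  have tr: "x + \<sigma> x + \<sigma> (\<sigma> x) \<in> range \<iota>" for x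
    unfolding fixed_iff[symmetric] by (simp add: assms)
  \<comment> \<open>The trace, pulled back to K; identities for \<open>T\<close> are checked after
    applying the injective \<open>\<iota>\<close>.\<close>
  define T where "T x = inv_into UNIV \<iota> (x + \<sigma> x + \<sigma> (\<sigma> x))" for x
  have \<iota>_T: "\<iota> (T x) = x + \<sigma> x + \<sigma> (\<sigma> x)" for x
    unfolding T_def by (rule f_inv_into_f[OF tr])
  have inj_\<iota>: "y = z" if "\<iota> y = \<iota> z" for y z
    using that \<iota>_simps(2)[of "y - z" z] \<iota>_eq_0_iff[of "y - z"] by simp
  have lin: "Vector_Spaces.linear (ext_scale \<iota>) (*) (\<lambda>x. T (m * x))" for m
    by unfold_locales (rule inj_\<iota>, simp add: \<iota>_T ext_scale_def algebra_simps)+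
  obtain B where B: "finite B" "ext.independent B" "card B = 4"
    by (rule finite_basis)
  obtain x where x: "x \<noteq> 0" "T (1 * x) = 0" "T (a * x) = 0" "T ((a * a) * x) = 0"
    by (rule ext.common_kernel_of_three_functionals[OF B(1,2) _ lin lin lin, of 1 a "a * a"])
      (use B(3) in auto)
  let ?y = "\<sigma> x" and ?z = "\<sigma> (\<sigma> x)"
  have "x + ?y + ?z = 0" "a * x + ?b * ?y + ?c * ?z = 0"
    "a * a * x + ?b * ?b * ?y + ?c * ?c * ?z = 0"
    using x(2-4) \<iota>_T[of "1 * x"] \<iota>_T[of "a * x"] \<iota>_T[of "a * a * x"] by simp_all
  \<comment> \<open>The multipliers 1, -(\<open>?b\<close> + \<open>?c\<close>),
    \<open>?b * ?c\<close> are the coefficients of (X - \<open>?b\<close>)(X - \<open>?c\<close>),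
    which vanishes at \<open>?b\<close> and \<open>?c\<close>, so only the term in \<open>x\<close>
    survives.\<close>
  moreover have "(a - ?b) * (a - ?c) * x = (a * a * x + ?b * ?b * ?y + ?c * ?c * ?z)
      - (?b + ?c) * (a * x + ?b * ?y + ?c * ?z) + ?b * ?c * (x + ?y + ?z)"
    by (simp add: algebra_simps)
  ultimately have "(a - ?b) * (a - ?c) * x = 0"
    by simp
  then show False
    using x(1) a ac by simp
qed

lemma quadratic_element:
  obtains x p q where "x \<notin> range \<iota>" "x * x = \<iota> p * x + \<iota> q"
proof -
  note result = that
  \<comment> \<open>\<open>x\<close> is a root of X^2 - (x + y) X + x y.\<close>
  have quad: thesis if "x \<notin> range \<iota>" "x + y \<in> range \<iota>" "x * y \<in> range \<iota>" for x y
  proof -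
    from that obtain p q where "x + y = \<iota> p" "x * y = \<iota> q"
      by blast
    moreover have "x * x = (x + y) * x - x * y"
      by (simp add: algebra_simps)
    ultimately have "x * x = \<iota> p * x + \<iota> (- q)"
      by (simp add: \<iota>_minus)
    then show thesis
      by (rule result[OF that(1)])
  qed
  have order_2: thesis if "x \<notin> range \<iota>" "\<sigma> (\<sigma> x) = x" for x
  proof (rule quad[OF that(1)])
    show "x + \<sigma> x \<in> range \<iota>" "x * \<sigma> x \<in> range \<iota>"
      unfolding fixed_iff[symmetric] by (simp_all add: that(2) ac_simps)
  qed
  \<comment> \<open>The sum and product of \<open>x\<close> and \<open>?y\<close> are fixed by the
    square of \<open>\<sigma>\<close>. If both lie in K, then \<open>x\<close> is quadratic;
    otherwise one of them falls under \<open>order_2\<close>.\<close>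
  have order_4: thesis if "x \<notin> range \<iota>" "\<sigma> (\<sigma> (\<sigma> (\<sigma> x))) = x" for x
  proof -
    let ?y = "\<sigma> (\<sigma> x)"
    consider "x + ?y \<in> range \<iota>" "x * ?y \<in> range \<iota>" | "x + ?y \<notin> range \<iota>" | "x * ?y \<notin> range \<iota>"
      by blast
    then show thesis
    proof cases
      case 1
      then show thesis
        by (rule quad[OF that(1)])
    next
      case 2
      then show thesis
        by (rule order_2) (simp add: that(2) add.commute)
    next
      case 3
      then show thesis
        by (rule order_2) (simp add: that(2) mult.commute)
    qed
  qed
  have "range \<iota> \<noteq> UNIV"
  proof
    assume "range \<iota> = UNIV"
    then have "UNIV \<subseteq> ext.span {1}"
      by (auto simp: ext.span_singleton ext_scale_def)
    then have "ext.dim UNIV \<le> card {1 :: 'l}"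
      by (rule ext.dim_le_card) simp
    then show False
      using dim_4 by simp
  qed
  \<comment> \<open>This choice of \<open>x\<close> excludes the return time 3 below.\<close>
  then obtain x where x: "\<sigma> (\<sigma> (\<sigma> x)) \<noteq> x"
    using range_eq_UNIV_if_order_3 by blast
  then have not_fixed: "x \<notin> range \<iota>"
    using fixed_iff by metis
  obtain d where d: "d \<in> {1..4}" "(\<sigma> ^^ d) x = x"
    by (rule orbit_length)
  from d(1) consider "d = 1" | "d = 2" | "d = 3" | "d = 4"
    by fastforce
  then show thesis
  proof cases
    case 1
    then show thesis
      using d(2) not_fixed fixed_iff by simp
  next
    case 2
    then show thesis
      using d(2) by (intro order_2[OF not_fixed]) (simp add: eval_nat_numeral)
  next
    case 3
    then show thesis
      using d(2) x by (simp add: eval_nat_numeral)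
  next
    case 4
    then show thesis
      using d(2) by (intro order_4[OF not_fixed]) (simp add: eval_nat_numeral)
  qed
qed

text \<open>A root \<open>s\<close> in K of the quadratic equation of \<open>x\<close> would bring
  the second root \<open>p - s\<close> with it, forcing \<open>x\<close> into K.\<close>

lemma irreducible_quadratic:
  obtains p q :: 'k where "\<And>s. s * s \<noteq> p * s + q"
proof -
  obtain x p q where x: "x \<notin> range \<iota>" "x * x = \<iota> p * x + \<iota> q"
    by (rule quadratic_element)
  have "s * s \<noteq> p * s + q" for s
  proof
    assume "s * s = p * s + q"
    then have "\<iota> s * \<iota> s = \<iota> p * \<iota> s + \<iota> q"
      by (metis \<iota>_simps(2,3))
    moreover have p: "\<iota> p = \<iota> (p - s) + \<iota> s"
      by (simp flip: \<iota>_simps(2))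
    ultimately have "(x - \<iota> s) * (x - \<iota> (p - s)) = 0"
      using x(2) by (simp add: algebra_simps)
    then show False
      using x(1) by auto
  qed
  then show thesis
    by (rule that)
qed

end

section \<open>From the Galois group to a generator\<close>

text \<open>The automorphisms fixing \<open>x\<close> form a subgroup; if it contains the generator,
  it is the whole group, whose fixed field is \<open>range \<iota>\<close>.\<close>

lemma fixed_by_generator_iff:
  fixes \<iota> :: "'k::field \<Rightarrow> 'l::field"
  assumes "galois_extension \<iota>" "\<sigma> \<in> carrier (galois_group \<iota>)"
    and "subgroup_generated (galois_group \<iota>) {\<sigma>} = galois_group \<iota>"
  shows "\<sigma> x = x \<longleftrightarrow> x \<in> range \<iota>"
proof
  interpret group "galois_group \<iota>"
    by (rule group_galois_group)
  assume fx: "\<sigma> x = x"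
  let ?S = "{\<tau> \<in> carrier (galois_group \<iota>). \<tau> x = x}"
  have "subgroup ?S (galois_group \<iota>)"
  proof (rule subgroupI)
    fix \<tau> assume "\<tau> \<in> ?S"
    then have t: "\<tau> \<in> carrier (galois_group \<iota>)" "\<tau> x = x"
      by auto
    then have "(inv\<^bsub>galois_group \<iota>\<^esub> \<tau> \<otimes>\<^bsub>galois_group \<iota>\<^esub> \<tau>) x = x"
      by (simp only: l_inv) (simp add: galois_group_def)
    then show "inv\<^bsub>galois_group \<iota>\<^esub> \<tau> \<in> ?S"
      using t inv_closed by (simp add: galois_group_def)
  next
    have "\<one>\<^bsub>galois_group \<iota>\<^esub> \<in> ?S"
      using one_closed by (simp add: galois_group_def)
    then show "?S \<noteq> {}" by blast
  next
    fix \<tau> \<rho> assume "\<tau> \<in> ?S" "\<rho> \<in> ?S"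
    then show "\<tau> \<otimes>\<^bsub>galois_group \<iota>\<^esub> \<rho> \<in> ?S"
      using m_closed[of \<tau> \<rho>] by (simp add: galois_group_def)
  qed auto
  then have "carrier (subgroup_generated (galois_group \<iota>) {\<sigma>}) \<subseteq> ?S"
    by (rule subgroup_generated_minimal) (use assms(2) fx in auto)
  then show "x \<in> range \<iota>"
    using assms(1,3) by (auto simp: galois_extension_def)
next
  assume "x \<in> range \<iota>"
  then show "\<sigma> x = x"
    using assms(2) by (auto simp: galois_group_def)
qed

lemma irreducible_quadratic_of_cyclic_quartic:
  fixes \<iota> :: "'k::field \<Rightarrow> 'l::field"
  assumes "galois_extension \<iota>" "ext_degree \<iota> = 4" "cyclic_group (galois_group \<iota>)"
  obtains p q :: 'k where "\<And>s. s * s \<noteq> p * s + q"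
proof -
  obtain \<sigma> where \<sigma>: "\<sigma> \<in> carrier (galois_group \<iota>)"
      "subgroup_generated (galois_group \<iota>) {\<sigma>} = galois_group \<iota>"
    using assms(3) by (auto simp: cyclic_group_def)
  interpret field_extension \<iota>
    using assms(1) by (simp add: galois_extension_def algebraic_extension_def)
  interpret cyclic_quartic \<iota> \<sigma>
  proof
    show "ext.dim UNIV = 4"
      using assms(2) by (simp add: ext_degree_def)
    show "field_hom \<sigma>"
      using \<sigma>(1) by (simp add: galois_group_def)
    show "\<sigma> x = x \<longleftrightarrow> x \<in> range \<iota>" for x
      by (rule fixed_by_generator_iff[OF assms(1) \<sigma>])
  qed
  show thesis
    by (rule irreducible_quadratic) (rule that)
qed

section \<open>The four-dimensional space of matrices\<close>

lemma vector_4 [simp]: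
  "(vector [w, x, y, z] :: 'a::zero^4) $ 1 = w"
  "(vector [w, x, y, z] :: 'a::zero^4) $ 2 = x"
  "(vector [w, x, y, z] :: 'a::zero^4) $ 3 = y"
  "(vector [w, x, y, z] :: 'a::zero^4) $ 4 = z"
  unfolding vector_def by simp_all

text \<open>The element \<open>x + y e\<close> of \<open>K(e)\<close> acts on the basis \<open>1, e\<close> by the block with rows
  \<open>(x, y q)\<close> and \<open>(y, x + y p)\<close>.\<close>

definition twisted_matrix :: "'k::field \<Rightarrow> 'k \<Rightarrow> 'k^4 \<Rightarrow> 'k^4^4"
  where "twisted_matrix p q v =
    (let a = v $ 1; b = v $ 2; c = v $ 3; t = v $ 4 in vector
      [vector [a, b * q, t, c * q],
       vector [b, a + b * p, c, t + c * p],
       vector [c, 0, a + b * p, - (b * q)],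
       vector [0, c, - b, a]])"

lemma linear_twisted_matrix:
  "Vector_Spaces.linear (*s) matrix_scale (twisted_matrix p q)"
  by unfold_locales
    (simp_all add: twisted_matrix_def matrix_scale_def Let_def vec_eq_iff forall_4 algebra_simps)

lemma inj_twisted_matrix: "inj (twisted_matrix p q)"
  by (rule injI) (auto simp: twisted_matrix_def Let_def vec_eq_iff forall_4)

text \<open>Computing in K(e) is replaced by explicit matrices over K: two factors turn the matrix
  into the scalar matrix of a norm, which is nonzero.\<close>

lemma det_twisted_matrix_nonzero:
  fixes p q :: "'k::field"
  assumes irred: "\<And>s. s * s \<noteq> p * s + q"
    and nz: "v $ 1 \<noteq> 0 \<or> v $ 2 \<noteq> 0 \<or> v $ 3 \<noteq> 0"
  shows "det (twisted_matrix p q v) \<noteq> 0"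
proof -
  \<comment> \<open>The form is the norm of x + y e; a zero with \<open>y\<close> nonzero would make
    -x/y a root of the quadratic.\<close>
  have anisotropic: "x = 0 \<and> y = 0" if "x * x + x * y * p - y * y * q = 0" for x y
  proof (rule ccontr)
    assume *: "\<not> (x = 0 \<and> y = 0)"
    with that have "y \<noteq> 0"
      by auto
    then have "(- (x / y)) * (- (x / y)) = p * (- (x / y)) + q"
      using that by (simp add: field_simps)
    then show False
      using irred by blast
  qed
  define a b c t where v_defs: "a = v $ 1" "b = v $ 2" "c = v $ 3" "t = v $ 4"
  define D where "D = a * a + a * b * p - b * b * q - c * t"
  txt \<open>\<open>adj\<close> is the adjugate over \<open>K(e)\<close>, \<open>cnj\<close> the conjugate of the determinant \<open>D - c\<^sup>2 e\<close>, and
    \<open>N\<close> its norm.\<close>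
  define adj where "adj = (vector
      [vector [a + b * p, - (b * q), - t, - (c * q)],
       vector [- b, a, - c, - t - c * p],
       vector [- c, 0, a, b * q],
       vector [0, - c, b, a + b * p]] :: 'k^4^4)"
  define cnj where "cnj = (vector
      [vector [D - c * c * p, c * c * q, 0, 0],
       vector [c * c, D, 0, 0],
       vector [0, 0, D - c * c * p, c * c * q],
       vector [0, 0, c * c, D]] :: 'k^4^4)"
  define N where "N = D * D + D * (- (c * c)) * p - (- (c * c)) * (- (c * c)) * q"
  have A: "twisted_matrix p q v = vector
      [vector [a, b * q, t, c * q],
       vector [b, a + b * p, c, t + c * p],
       vector [c, 0, a + b * p, - (b * q)],
       vector [0, c, - b, a]]"
    by (simp add: twisted_matrix_def Let_def v_defs)
  \<comment> \<open>The product is the scalar D - c^2 e of K(e), as two diagonal blocks.\<close>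
  have A_adj: "twisted_matrix p q v ** adj = (vector
      [vector [D, - (c * c * q), 0, 0],
       vector [- (c * c), D - c * c * p, 0, 0],
       vector [0, 0, D, - (c * c * q)],
       vector [0, 0, - (c * c), D - c * c * p]] :: 'k^4^4)"
    by (simp add: A adj_def D_def matrix_matrix_mult_def vec_eq_iff forall_4 sum_4)
      (simp add: algebra_simps)
  have "twisted_matrix p q v ** adj ** cnj = mat N"
    unfolding A_adj
    by (simp add: cnj_def N_def matrix_matrix_mult_def mat_def vec_eq_iff forall_4 sum_4)
      (simp add: algebra_simps)
  moreover have "det (mat N :: 'k^4^4) = N ^ 4"
    by (subst det_diagonal) (simp_all add: mat_def)
  ultimately have "det (twisted_matrix p q v) * det adj * det cnj = N ^ 4"
    by (metis det_mul)
  moreover have "N \<noteq> 0"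
  proof
    assume "N = 0"
    \<comment> \<open>\<open>N\<close> is the norm form at \<open>D\<close> and
      \<open>- (c * c)\<close>.\<close>
    then have "D = 0 \<and> - (c * c) = 0"
      unfolding N_def by (rule anisotropic)
    then have "c = 0" "a * a + a * b * p - b * b * q = 0"
      by (auto simp: D_def)
    then show False
      using anisotropic[of a b] nz by (simp add: v_defs)
  qed
  ultimately show ?thesis
    by auto
qed

lemma det_twisted_matrix_eq_0_iff:
  fixes p q :: "'k::field"
  assumes "\<And>s. s * s \<noteq> p * s + q"
  shows "det (twisted_matrix p q v) = 0 \<longleftrightarrow> v $ 1 = 0 \<and> v $ 2 = 0 \<and> v $ 3 = 0"
proof (cases "v $ 1 = 0 \<and> v $ 2 = 0 \<and> v $ 3 = 0")
  case True
  then have "row 3 (twisted_matrix p q v) = 0"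
    by (simp add: row_def twisted_matrix_def Let_def vec_eq_iff forall_4)
  then show ?thesis
    using True det_zero_row(2) by blast
next
  case False
  then show ?thesis
    using det_twisted_matrix_nonzero[OF assms] by blast
qed

lemma rank_twisted_matrix_singular:
  assumes "v $ 1 = 0" "v $ 2 = 0" "v $ 3 = 0" "v $ 4 \<noteq> 0"
  shows "rank (twisted_matrix p q v) = 2"
proof -
  let ?A = "twisted_matrix p q v"
  \<comment> \<open>The two nonzero rows of \<open>?A\<close>.\<close>
  define x y where xy: "x = v $ 4 *s axis (3::4) (1::'a)" "y = v $ 4 *s axis (4::4) (1::'a)"
  have entries: "x $ 3 \<noteq> 0" "y $ 3 = 0" "y $ 4 \<noteq> 0"
    using assms(4) by (simp_all add: xy axis_def)
  have "x \<notin> vec.span {y}"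
  proof
    assume "x \<in> vec.span {y}"
    then obtain k where "x = k *s y"
      by (auto simp: vec.span_singleton)
    then show False
      using entries(1,2) by simp
  qed
  moreover have "y \<noteq> 0"
    using entries(3) by auto
  ultimately have ind: "vec.independent {x, y}" and "x \<noteq> y"
    by (auto simp: vec.independent_insert vec.span_base)
  have "row 1 ?A = x" "row 2 ?A = y" "row 3 ?A = 0" "row 4 ?A = 0"
    using assms(1-3)
    by (simp_all add: row_def twisted_matrix_def Let_def xy axis_def vec_eq_iff forall_4)
  moreover have "rows ?A = (\<lambda>i. row i ?A) ` {1, 2, 3, 4}"
    unfolding rows_def UNIV_4[symmetric] by blast
  ultimately have "vec.span (rows ?A) = vec.span {x, y}"
    by (simp add: insert_commute[of _ 0] vec.span_insert_0)
  then have "rank ?A = vec.dim {x, y}"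
    unfolding row_rank_def_gen by (metis vec.dim_span)
  also have "\<dots> = card {x, y}"
    using ind by (rule vec.dim_eq_card_independent)
  finally show ?thesis
    using \<open>x \<noteq> y\<close> by simp
qed

lemma nilpotent_twisted_matrix_singular:
  assumes "v $ 1 = 0" "v $ 2 = 0" "v $ 3 = 0"
  shows "nilpotent_matrix (twisted_matrix p q v)"
  unfolding nilpotent_matrix_def
proof
  \<comment> \<open>Only the upper right block, a scalar multiple of the identity, is left, so the
    square vanishes.\<close>
  show "(((**) (twisted_matrix p q v)) ^^ 2) (mat 1) = 0"
    using assms by (simp add: eval_nat_numeral twisted_matrix_def Let_def matrix_matrix_mult_def
        vec_eq_iff forall_4 sum_4)
qed

theorem theorem8:
  fixes \<iota> :: "'k::field \<Rightarrow> 'l::field"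
  assumes "CHAR('k) = 2"
    and "galois_extension \<iota>"
    and "ext_degree \<iota> = 4"
    and "cyclic_group (galois_group \<iota>)"
  shows "\<exists>M :: ('k^4^4) set.
      matsp.subspace M \<and> matsp.dim M = 4 \<and>
      matsp.subspace {A \<in> M. det A = 0} \<and> matsp.dim {A \<in> M. det A = 0} = 1 \<and>
      mat 1 \<in> M \<and>
      (\<forall>A\<in>M. A \<noteq> 0 \<and> det A = 0 \<longrightarrow> rank A = 2 \<and> nilpotent_matrix A)"
proof -
  obtain p q :: 'k where irred: "\<And>s. s * s \<noteq> p * s + q"
    by (rule irreducible_quadratic_of_cyclic_quartic[OF assms(2-4)]) blast
  let ?f = "twisted_matrix p q"
  let ?M = "range ?f"
  interpret fd: finite_dimensional_vector_space_pair_1 "(*s)" cart_basis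
    "matrix_scale :: 'k \<Rightarrow> 'k^4^4 \<Rightarrow> _" ..
  interpret f: Vector_Spaces.linear "(*s)" matrix_scale ?f
    by (rule linear_twisted_matrix)
  note sing = det_twisted_matrix_eq_0_iff[OF irred]
  \<comment> \<open>The singular matrices are those where only the coordinate t may be
    nonzero.\<close>
  have ker: "{A \<in> ?M. det A = 0} = ?f ` vec.span {axis 4 1}"
  proof -
    have "v \<in> vec.span {axis 4 1} \<longleftrightarrow> v $ 1 = 0 \<and> v $ 2 = 0 \<and> v $ 3 = 0" for v :: "'k^4"
      by (auto simp: vec.span_singleton vec_eq_iff forall_4 axis_def)
    then show ?thesis
      by (auto simp: sing)
  qed
  \<comment> \<open>Injectivity of \<open>?f\<close> moves every dimension count to the coordinate
    space.\<close>
  have dim_f: "matsp.dim (?f ` S) = vec.dim S" for S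
    by (rule fd.dim_image_eq[OF linear_twisted_matrix inj_on_subset[OF inj_twisted_matrix]]) simp
  show ?thesis
  proof (intro exI[of _ ?M] conjI ballI impI)
    show "matsp.subspace ?M"
      by (intro f.subspace_image vec.subspace_UNIV)
    show "matsp.dim ?M = 4"
      by (simp add: dim_f vec.dim_UNIV vec.dimension_def card_cart_basis)
    show "matsp.subspace {A \<in> ?M. det A = 0}"
      unfolding ker by (intro f.subspace_image vec.subspace_span)
    have "vec.dim {axis 4 1 :: 'k^4} = 1"
      by (subst vec.dim_eq_card_independent) auto
    then show "matsp.dim {A \<in> ?M. det A = 0} = 1"
      by (simp add: ker dim_f)
    \<comment> \<open>The identity has coordinates a = 1 and b = c = t = 0.\<close>
    show "mat 1 \<in> ?M"
      by (rule range_eqI[of _ _ "axis 1 1"])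
        (simp add: twisted_matrix_def Let_def mat_def axis_def vec_eq_iff forall_4)
    fix A assume "A \<in> ?M" "A \<noteq> 0 \<and> det A = 0"
    then obtain v where v: "A = ?f v" "v $ 1 = 0" "v $ 2 = 0" "v $ 3 = 0"
      using sing by auto
    have "v \<noteq> 0"
      using \<open>A \<noteq> 0 \<and> det A = 0\<close> v(1) f.zero by blast
    then have "v $ 4 \<noteq> 0"
      using v(2-4) by (auto simp: vec_eq_iff forall_4)
    with v show "rank A = 2" "nilpotent_matrix A"
      by (simp_all add: rank_twisted_matrix_singular nilpotent_twisted_matrix_singular)
  qed
qed

end
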